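(* Let $G$ be a graph without isolated vertices. For every matching $M$ of clauses of $\psi(G)$ and every set $\mathbf{S}$ of satisfying assignments of $\psi(G)$ that fixes $M$, we have $Pr(\mathbf{S}) \leq (7/8)^{|M|}$, where $Pr$ is the probability in the Vertex-Edge probability space $\mathcal{VE}(G)$.
   Context: $\psi(G)$ is the CNF with variable set $V(G)\cup E(G)$ and, for each edge $e=\{u,v\}$, the clause $(u\vee e\vee v)$, viewed as the set of literals $\{u,e,v\}$. An assignment is a set of literals with no variable together with its negation; $\mathbf{SAT}(G)$ is the set of satisfying assignments of $\psi(G)$ with variable set exactly $V(G)\cup E(G)$. The space $\mathcal{VE}(G)$ has universe $\mathbf{SAT}(G)$; for $S\in\mathbf{SAT}(G)$, an edge $\{u,v\}$ is free for $S$ if $u$ or $v$ occurs positively in $S$, $Free(S)$ is the set of free edges, and $Pr(S)=2^{-(|V(G)|+|Free(S)|)}$; the probability of a set is the sum of the probabilities of its elements. A set $\mathbf{S}\subseteq\mathbf{SAT}(G)$ fixes a clause $C$ if there is a proper subset $C'\subset C$ such that $S\cap C'\neq\emptyset$ for every $S\in\mathbf{S}$; it fixes a set of clauses if it fixes each of them. A matching of clauses is a set of clauses of $\psi(G)$ whose corresponding edges form a matching of $G$. *)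

theory Defs
  imports "HOL-Analysis.Analysis"
begin

definition simple_graph :: "'a set \<Rightarrow> 'a set set \<Rightarrow> bool" where
  "simple_graph V E \<longleftrightarrow> finite V \<and> (\<forall>e\<in>E. e \<subseteq> V \<and> card e = 2)"

definition isolated_vertex :: "'a set \<Rightarrow> 'a set set \<Rightarrow> 'a \<Rightarrow> bool" where
  "isolated_vertex V E v \<longleftrightarrow> v \<in> V \<and> (\<forall>e\<in>E. v \<notin> e)"

definition graph_matching :: "'a set set \<Rightarrow> 'a set set \<Rightarrow> bool" where
  "graph_matching E F \<longleftrightarrow> F \<subseteq> E \<and> pairwise disjnt F"

text \<open>The two constructors make the union of vertices and edges disjoint by construction.\<close>

datatype 'a variable = Vertex 'a | Edge "'a set"

datatype 'b literal = Pos (var_of: 'b) | Neg (var_of: 'b)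

definition assignment :: "'b literal set \<Rightarrow> bool" where
  "assignment S \<longleftrightarrow> \<not> (\<exists>x. Pos x \<in> S \<and> Neg x \<in> S)"

definition satisfies :: "'b literal set \<Rightarrow> 'b literal set set \<Rightarrow> bool" where
  "satisfies S \<phi> \<longleftrightarrow> (\<forall>C\<in>\<phi>. S \<inter> C \<noteq> {})"

definition graph_vars :: "'a set \<Rightarrow> 'a set set \<Rightarrow> 'a variable set" where
  "graph_vars V E = Vertex ` V \<union> Edge ` E"

text \<open>For \<open>e = {u, v}\<close> this is \<open>{Pos (Vertex u), Pos (Edge e), Pos (Vertex v)}\<close>.\<close>

definition edge_clause :: "'a set \<Rightarrow> 'a variable literal set" where
  "edge_clause e = insert (Pos (Edge e)) ((\<lambda>u. Pos (Vertex u)) ` e)"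

definition graph_cnf :: "'a set set \<Rightarrow> 'a variable literal set set" where
  "graph_cnf E = edge_clause ` E"

definition SAT :: "'a set \<Rightarrow> 'a set set \<Rightarrow> 'a variable literal set set" where
  "SAT V E = {S. assignment S \<and> var_of ` S = graph_vars V E \<and> satisfies S (graph_cnf E)}"

definition free_edges :: "'a set set \<Rightarrow> 'a variable literal set \<Rightarrow> 'a set set" where
  "free_edges E S = {e \<in> E. \<exists>u\<in>e. Pos (Vertex u) \<in> S}"

definition VE_weight :: "'a set \<Rightarrow> 'a set set \<Rightarrow> 'a variable literal set \<Rightarrow> real" where
  "VE_weight V E S = (1 / 2) ^ (card V + card (free_edges E S))"

definition VE_space :: "'a set \<Rightarrow> 'a set set \<Rightarrow> 'a variable literal set measure" where
  "VE_space V E = point_measure (SAT V E) (\<lambda>S. ennreal (VE_weight V E S))"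

definition fixes_clause :: "'b literal set set \<Rightarrow> 'b literal set \<Rightarrow> bool" where
  "fixes_clause \<S> C \<longleftrightarrow> (\<exists>C'. C' \<subset> C \<and> (\<forall>S\<in>\<S>. S \<inter> C' \<noteq> {}))"

definition fixes_clauses :: "'b literal set set \<Rightarrow> 'b literal set set \<Rightarrow> bool" where
  "fixes_clauses \<S> M \<longleftrightarrow> (\<forall>C\<in>M. fixes_clause \<S> C)"

definition clause_matching :: "'a set set \<Rightarrow> 'a variable literal set set \<Rightarrow> bool" where
  "clause_matching E M \<longleftrightarrow>
     M \<subseteq> graph_cnf E \<and> graph_matching E {e \<in> E. edge_clause e \<in> M}"

lemma finite_SAT:
  assumes "simple_graph V E"
  shows "finite (SAT V E)"
proof -
  have "finite V" "E \<subseteq> Pow V"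
    using assms by (auto simp: simple_graph_def)
  then have "finite (graph_vars V E)"
    by (simp add: graph_vars_def finite_subset)
  then have "finite (Pow (Pos ` graph_vars V E \<union> Neg ` graph_vars V E))"
    by simp
  moreover have "SAT V E \<subseteq> Pow (Pos ` graph_vars V E \<union> Neg ` graph_vars V E)"
  proof
    fix S assume S: "S \<in> SAT V E"
    have "l \<in> Pos ` graph_vars V E \<union> Neg ` graph_vars V E" if "l \<in> S" for l
    proof -
      have "var_of l \<in> graph_vars V E"
        using S that by (auto simp: SAT_def)
      then show ?thesis by (cases l) auto
    qed
    then show "S \<in> Pow (Pos ` graph_vars V E \<union> Neg ` graph_vars V E)" by blast
  qed
  ultimately show ?thesis by (rule finite_subset[rotated])
qed

lemma measure_VE_space:
  assumes "simple_graph V E" and "\<S> \<subseteq> SAT V E"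
  shows "measure (VE_space V E) \<S> = (\<Sum>S\<in>\<S>. VE_weight V E S)"
proof -
  have "finite \<S>" using finite_SAT[OF assms(1)] assms(2) finite_subset by blast
  then have "emeasure (VE_space V E) \<S> = (\<Sum>S\<in>\<S>. ennreal (VE_weight V E S))"
    unfolding VE_space_def by (rule emeasure_point_measure_finite2[OF assms(2)])
  also have "\<dots> = ennreal (\<Sum>S\<in>\<S>. VE_weight V E S)"
    by (rule sum_ennreal) (simp add: VE_weight_def)
  finally show ?thesis
    by (simp add: measure_def sum_nonneg VE_weight_def)
qed

end

theory Submission
  imports Defs
begin

text \<open>
  Draw a set \<open>A\<close> of variables of \<open>\<psi>(G)\<close> uniformly at random and make true the variables in \<open>A\<close>
  together with all edges that have no endpoint in \<open>A\<close>.  A satisfying assignment \<open>S\<close> arises from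
  exactly those \<open>A\<close> obtained from its set of true variables by deleting some non-free edges, so it
  has probability \<open>2\<^sup>-\<^sup>(|V| + |Free(S)|)\<close>: this is the Vertex-Edge space.  If all assignments in
  \<open>\<S>\<close> hit \<open>C' \<subset> C\<close> and \<open>x\<close> is a variable of \<open>C\<close> missing in \<open>C'\<close>, then \<open>A\<close> cannot meet the variables
  of \<open>C\<close> exactly in \<open>x\<close>.  This excludes one of eight equiprobable patterns, independently for
  the clauses of a matching, whose variable sets are disjoint.
\<close>

text \<open>Independence of the blocks \<open>B i\<close>, as a count: \<open>A\<close> splits into
  its trace on \<open>B i\<close>, with \<open>2 ^ k - 1\<close> admissible values, and
  \<open>A - B i\<close>, to which the induction hypothesis applies.\<close>

lemma card_avoiding_patterns_le:
  fixes B P :: "'i \<Rightarrow> 'x set"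
  assumes "finite I" "finite X"
    and "\<And>i. i \<in> I \<Longrightarrow> B i \<subseteq> X \<and> P i \<subseteq> B i \<and> card (B i) = k"
    and "disjoint_family_on B I"
  shows "real (card {A. A \<subseteq> X \<and> (\<forall>i\<in>I. A \<inter> B i \<noteq> P i)}) \<le> (1 - 1 / 2 ^ k) ^ card I * 2 ^ card X"
  using assms
proof (induction I arbitrary: X rule: finite_induct)
  case empty
  then show ?case by (simp add: card_Pow flip: Pow_def)
next
  case (insert i I)
  \<comment> \<open>The ground set varies too, since the induction step passes from \<open>X\<close>
    to \<open>X - B i\<close>.\<close>
  define Q where "Q Y J = {A. A \<subseteq> Y \<and> (\<forall>j\<in>J. A \<inter> B j \<noteq> P j)}" for Y J
  have i: "B i \<subseteq> X" "P i \<subseteq> B i" "card (B i) = k" using insert.prems by auto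
  have fin: "finite (B i)" "finite (X - B i)"
    using i(1) insert.prems(1) by (auto intro: finite_subset)
  have disj: "B j \<inter> B i = {}" if "j \<in> I" for j
    using insert that by (auto simp: disjoint_family_on_def)
  have IH: "real (card (Q (X - B i) I)) \<le> (1 - 1 / 2 ^ k) ^ card I * 2 ^ card (X - B i)"
    unfolding Q_def
  proof (rule insert.IH)
    show "B j \<subseteq> X - B i \<and> P j \<subseteq> B j \<and> card (B j) = k" if "j \<in> I" for j
      using insert.prems(2)[of j] disj[OF that] that by auto
    show "disjoint_family_on B I"
      using insert.prems(3) by (auto simp: disjoint_family_on_def)
  qed (use fin in auto)
  have finQ: "finite (Q (X - B i) I)"
    unfolding Q_def by (rule finite_subset[of _ "Pow (X - B i)"]) (use fin in auto)
  let ?f = "\<lambda>A. (A \<inter> B i, A - B i)"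
  have "card (Q X (insert i I)) \<le> card ((Pow (B i) - {P i}) \<times> Q (X - B i) I)"
  proof (rule card_inj_on_le)
    show "inj_on ?f (Q X (insert i I))" by (auto simp: inj_on_def)
    \<comment> \<open>Removing one block leaves the traces on the others unchanged, so
      \<open>A - B i\<close> still avoids their patterns.\<close>
    have "(A - B i) \<inter> B j = A \<inter> B j" if "j \<in> I" for A j
      using disj[OF that] by auto
    then show "?f ` Q X (insert i I) \<subseteq> (Pow (B i) - {P i}) \<times> Q (X - B i) I"
      by (auto simp: Q_def)
  qed (use fin finQ in auto)
  also have "\<dots> = (2 ^ k - 1) * card (Q (X - B i) I)"
    using fin i by (simp add: card_cartesian_product card_Diff_singleton card_Pow)
  finally have "real (card (Q X (insert i I))) \<le> real ((2 ^ k - 1) * card (Q (X - B i) I))"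
    by (rule of_nat_mono)
  also have "\<dots> = (2 ^ k - 1) * real (card (Q (X - B i) I))"
    by (simp add: of_nat_diff)
  also have "\<dots> \<le> (2 ^ k - 1) * ((1 - 1 / 2 ^ k) ^ card I * 2 ^ card (X - B i))"
    by (rule mult_left_mono[OF IH]) simp
  also have "\<dots> = (1 - 1 / 2 ^ k) * (1 - 1 / 2 ^ k) ^ card I * (2 ^ k * 2 ^ card (X - B i))"
    by (simp add: field_simps)
  also have "2 ^ k * 2 ^ card (X - B i) = (2 ^ card X :: real)"
  proof -
    have "card X = k + card (X - B i)"
      using i fin insert.prems(1) card_mono[of X "B i"] by (simp add: card_Diff_subset)
    then show ?thesis by (simp add: power_add)
  qed
  finally show ?case using insert.hyps by (simp add: Q_def)
qed

definition completed :: "'a set set \<Rightarrow> 'a variable set \<Rightarrow> 'a variable set" where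
  "completed E A = A \<union> Edge ` {e \<in> E. \<forall>u\<in>e. Vertex u \<notin> A}"

definition completed_assignment ::
    "'a set \<Rightarrow> 'a set set \<Rightarrow> 'a variable set \<Rightarrow> 'a variable literal set" where
  "completed_assignment V E A =
     Pos ` completed E A \<union> Neg ` (graph_vars V E - completed E A)"

lemma finite_graph:
  assumes "simple_graph V E"
  shows "finite V" "finite E"
  using assms finite_subset[of E "Pow V"] by (auto simp: simple_graph_def)

lemma card_graph_vars:
  assumes "simple_graph V E"
  shows "finite (graph_vars V E)" "card (graph_vars V E) = card V + card E"
proof -
  have "Vertex ` V \<inter> Edge ` E = {}" by auto
  then show "finite (graph_vars V E)" "card (graph_vars V E) = card V + card E"
    using finite_graph[OF assms]
    by (simp_all add: graph_vars_def card_Un_disjoint card_image inj_on_def)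
qed

lemma SAT_edge_not_free:
  assumes "S \<in> SAT V E" "e \<in> E" "\<forall>u\<in>e. Pos (Vertex u) \<notin> S"
  shows "Pos (Edge e) \<in> S"
  using assms by (fastforce simp: SAT_def satisfies_def graph_cnf_def edge_clause_def)

text \<open>Deleting \<open>D\<close> leaves the true vertices as they were. Completion therefore
  restores \<open>D\<close>, and any other edge that it adds is already true in \<open>S\<close>,
  because \<open>S\<close> satisfies that edge's clause. Negative literals agree since
  \<open>S\<close> gives each variable exactly one sign.\<close>

lemma completed_assignment_eq:
  assumes S: "S \<in> SAT V E" and D: "D \<subseteq> E - free_edges E S"
  shows "completed_assignment V E ({x. Pos x \<in> S} - Edge ` D) = S"
proof -
  have vars: "var_of ` S = graph_vars V E" and asg: "assignment S"
    using S by (auto simp: SAT_def)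
  have comp: "completed E ({x. Pos x \<in> S} - Edge ` D) = {x. Pos x \<in> S}"
    (is "?P = _")
  proof (rule set_eqI)
    fix x
    show "x \<in> ?P \<longleftrightarrow> x \<in> {x. Pos x \<in> S}"
    proof (cases x)
      case (Vertex u)
      then show ?thesis by (auto simp: completed_def)
    next
      case (Edge e)
      have "Edge e \<in> ?P \<longleftrightarrow>
          Pos (Edge e) \<in> S \<and> e \<notin> D \<or> e \<in> E \<and> (\<forall>u\<in>e. Pos (Vertex u) \<notin> S)"
        by (simp add: completed_def image_iff)
      moreover have "e \<in> D \<Longrightarrow> e \<in> E \<and> (\<forall>u\<in>e. Pos (Vertex u) \<notin> S)"
        using D by (auto simp: free_edges_def)
      ultimately show ?thesis
        using SAT_edge_not_free[OF S, of e] Edge by blast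
    qed
  qed
  have neg: "Neg x \<in> S \<longleftrightarrow> x \<in> graph_vars V E \<and> Pos x \<notin> S" for x
  proof
    assume *: "Neg x \<in> S"
    then have "x \<in> graph_vars V E" using imageI[OF *, of var_of] by (simp only: vars literal.sel)
    with * show "x \<in> graph_vars V E \<and> Pos x \<notin> S"
      using asg unfolding assignment_def by blast
  next
    assume *: "x \<in> graph_vars V E \<and> Pos x \<notin> S"
    then have "x \<in> var_of ` S" by (simp add: vars)
    then obtain l where "l \<in> S" "var_of l = x" by blast
    with * show "Neg x \<in> S" by (cases l) auto
  qed
  have "l \<in> completed_assignment V E ({x. Pos x \<in> S} - Edge ` D) \<longleftrightarrow> l \<in> S" for l
    by (cases l) (simp_all add: completed_assignment_def comp neg image_iff)
  then show ?thesis by blast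
qed

text \<open>Distinct sets of deleted non-free edges give distinct preimages of \<open>S\<close>.
  There are \<open>2 ^ card (E - free_edges E S)\<close> of them, which is exactly the left-hand
  side because \<open>graph_vars V E\<close> has \<open>card V + card E\<close> elements.\<close>

lemma VE_weight_le_card_fibre:
  assumes G: "simple_graph V E" and S: "S \<in> SAT V E"
  shows "VE_weight V E S * 2 ^ card (graph_vars V E)
    \<le> card {A. A \<subseteq> graph_vars V E \<and> completed_assignment V E A = S}"
proof -
  let ?N = "E - free_edges E S"
  let ?f = "\<lambda>D. {x. Pos x \<in> S} - Edge ` D"
  note fin = finite_graph[OF G] card_graph_vars[OF G]
  have sub: "{x. Pos x \<in> S} \<subseteq> graph_vars V E"
    using S by (force simp: SAT_def)
  have pos: "Pos (Edge e) \<in> S" if "e \<in> ?N" for e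
    using that SAT_edge_not_free[OF S] by (auto simp: free_edges_def)
  have "inj_on ?f (Pow ?N)"
  proof (rule inj_on_inverseI)
    fix D assume "D \<in> Pow ?N"
    \<comment> \<open>All non-free edges are true in \<open>S\<close>, so those missing from
      \<open>?f D\<close> are exactly the deleted ones.\<close>
    then show "{e \<in> ?N. Edge e \<notin> ?f D} = D" using pos by auto
  qed
  moreover have "?f ` Pow ?N \<subseteq> {A. A \<subseteq> graph_vars V E \<and> completed_assignment V E A = S}"
    using completed_assignment_eq[OF S] sub by blast
  ultimately have "card (Pow ?N) \<le> card {A. A \<subseteq> graph_vars V E \<and> completed_assignment V E A = S}"
    using fin by (intro card_inj_on_le) auto
  then have "(2::nat) ^ card ?N \<le> card {A. A \<subseteq> graph_vars V E \<and> completed_assignment V E A = S}"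
    using fin by (simp add: card_Pow)
  then have "real (2 ^ card ?N) \<le> card {A. A \<subseteq> graph_vars V E \<and> completed_assignment V E A = S}"
    by (rule of_nat_mono)
  moreover have "VE_weight V E S * 2 ^ card (graph_vars V E) = real (2 ^ card ?N)"
  proof -
    have "free_edges E S \<subseteq> E" by (auto simp: free_edges_def)
    then have "card E = card (free_edges E S) + card ?N"
      using fin card_mono[of E "free_edges E S"] by (simp add: card_Diff_subset finite_subset)
    then show ?thesis
      using fin by (simp add: VE_weight_def power_add power_one_over field_simps)
  qed
  ultimately show ?thesis by simp
qed

text \<open>Fibres over different assignments are disjoint, so the fibre bounds add up. This turns
  the weighted sum into a count of subsets of \<open>graph_vars V E\<close>.\<close>

lemma measure_VE_space_le_card:
  assumes G: "simple_graph V E" and sub: "\<S> \<subseteq> SAT V E"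
  shows "measure (VE_space V E) \<S> * 2 ^ card (graph_vars V E)
    \<le> card {A. A \<subseteq> graph_vars V E \<and> completed_assignment V E A \<in> \<S>}"
proof -
  let ?X = "graph_vars V E"
  let ?fib = "\<lambda>S. {A. A \<subseteq> ?X \<and> completed_assignment V E A = S}"
  have fin: "finite \<S>" using finite_SAT[OF G] sub finite_subset by blast
  have "measure (VE_space V E) \<S> * 2 ^ card ?X = (\<Sum>S\<in>\<S>. VE_weight V E S * 2 ^ card ?X)"
    by (simp add: measure_VE_space[OF assms] sum_distrib_right)
  also have "\<dots> \<le> (\<Sum>S\<in>\<S>. real (card (?fib S)))"
    using VE_weight_le_card_fibre[OF G] sub by (intro sum_mono) blast
  also have "\<dots> = real (card (\<Union>S\<in>\<S>. ?fib S))"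
    using fin card_graph_vars(1)[OF G] by (subst card_UN_disjoint) auto
  also have "(\<Union>S\<in>\<S>. ?fib S) = {A. A \<subseteq> ?X \<and> completed_assignment V E A \<in> \<S>}"
    by blast
  finally show ?thesis .
qed

definition edge_vars :: "'a set \<Rightarrow> 'a variable set" where
  "edge_vars e = insert (Edge e) (Vertex ` e)"

lemma edge_clause_eq: "edge_clause e = Pos ` edge_vars e"
  by (auto simp: edge_clause_def edge_vars_def)

lemma card_edge_vars:
  assumes "simple_graph V E" "e \<in> E"
  shows "card (edge_vars e) = 3"
proof -
  have "card e = 2" using assms by (auto simp: simple_graph_def)
  then show ?thesis
    by (subst edge_vars_def, subst card_insert_disjoint)
      (auto simp: card_image inj_on_def intro: card_ge_0_finite)
qed

text \<open>On \<open>edge_vars e\<close>, completion can only add \<open>Edge e\<close>, and only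
  if \<open>e\<close> has no endpoint in \<open>A\<close>. If \<open>x\<close> is a vertex, it is
  such an endpoint; otherwise \<open>x\<close> is \<open>Edge e\<close> itself.\<close>

lemma completed_inter_edge_vars:
  assumes "A \<inter> edge_vars e = {x}"
  shows "completed E A \<inter> edge_vars e = {x}"
proof (cases x)
  case (Vertex u)
  then have "Vertex u \<in> A \<inter> edge_vars e" by (simp add: assms)
  then have "u \<in> e" "Vertex u \<in> A" by (auto simp: edge_vars_def)
  then have "completed E A \<inter> edge_vars e = A \<inter> edge_vars e"
    by (auto simp: completed_def edge_vars_def)
  then show ?thesis using assms by simp
next
  case (Edge d)
  then have "Edge d \<in> A \<inter> edge_vars e" by (simp add: assms)
  then have "Edge e \<in> A" by (auto simp: edge_vars_def)
  then have "completed E A \<inter> edge_vars e = A \<inter> edge_vars e"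
    by (auto simp: completed_def edge_vars_def)
  then show ?thesis using assms by simp
qed

text \<open>Take \<open>x\<close> with \<open>Pos x\<close> in the clause but outside
  \<open>C'\<close>. If \<open>A\<close> met the clause only in \<open>x\<close>, then
  \<open>x\<close> would remain its only true variable after completion, and the assignment would
  miss \<open>C'\<close>.\<close>

lemma fixes_clause_excludes_pattern:
  assumes "fixes_clause \<S> (edge_clause e)"
  obtains x where "x \<in> edge_vars e"
    and "\<And>A. completed_assignment V E A \<in> \<S> \<Longrightarrow> A \<inter> edge_vars e \<noteq> {x}"
proof -
  obtain C' where C': "C' \<subset> Pos ` edge_vars e" and hit: "\<forall>S\<in>\<S>. S \<inter> C' \<noteq> {}"
    using assms(1) by (auto simp: fixes_clause_def edge_clause_eq)
  then obtain x where x: "x \<in> edge_vars e" "Pos x \<notin> C'" by blast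
  have "A \<inter> edge_vars e \<noteq> {x}" if A: "completed_assignment V E A \<in> \<S>" for A
  proof
    assume "A \<inter> edge_vars e = {x}"
    then have eq: "completed E A \<inter> edge_vars e = {x}" by (rule completed_inter_edge_vars)
    obtain l where l: "l \<in> completed_assignment V E A" "l \<in> C'" using hit A by blast
    then obtain y where "l = Pos y" "y \<in> edge_vars e" using C' by blast
    moreover from this have "y \<in> completed E A"
      using l(1) by (auto simp: completed_assignment_def)
    ultimately have "y = x" using eq by blast
    then show False using l x \<open>l = Pos y\<close> by simp
  qed
  with x show ?thesis using that by blast
qed

theorem theorem8:
  fixes V :: "'a set" and E :: "'a set set"
    and M :: "'a variable literal set set" and \<S> :: "'a variable literal set set"
  assumes "simple_graph V E"
    and "\<nexists>v. isolated_vertex V E v"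
    and "clause_matching E M"
    and "\<S> \<subseteq> SAT V E"
    and "fixes_clauses \<S> M"
  shows "measure (VE_space V E) \<S> \<le> (7 / 8) ^ card M"
proof -
  let ?X = "graph_vars V E"
  define F where "F = {e \<in> E. edge_clause e \<in> M}"
  have F: "F \<subseteq> E" "pairwise disjnt F" and M: "M = edge_clause ` F"
    using assms(3) by (auto simp: clause_matching_def graph_matching_def graph_cnf_def F_def)
  have fin: "finite F" "finite ?X"
    using F(1) finite_graph[OF assms(1)] card_graph_vars[OF assms(1)] finite_subset by auto
  \<comment> \<open>The forbidden variable depends on the edge alone, so a single pattern per edge
    serves for all \<open>A\<close>.\<close>
  have "\<forall>e\<in>F. \<exists>x. x \<in> edge_vars e \<and>
      (\<forall>A. completed_assignment V E A \<in> \<S> \<longrightarrow> A \<inter> edge_vars e \<noteq> {x})"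
  proof
    fix e assume "e \<in> F"
    then have "fixes_clause \<S> (edge_clause e)"
      using assms(5) by (auto simp: fixes_clauses_def F_def)
    from fixes_clause_excludes_pattern[OF this] show "\<exists>x. x \<in> edge_vars e \<and>
        (\<forall>A. completed_assignment V E A \<in> \<S> \<longrightarrow> A \<inter> edge_vars e \<noteq> {x})"
      by metis
  qed
  from bchoice[OF this] obtain x where x: "\<And>e. e \<in> F \<Longrightarrow> x e \<in> edge_vars e"
    and avoid: "\<And>e A. e \<in> F \<Longrightarrow> completed_assignment V E A \<in> \<S> \<Longrightarrow> A \<inter> edge_vars e \<noteq> {x e}"
    by blast
  have "disjoint_family_on edge_vars F"
    using F(2) by (auto simp: disjoint_family_on_def pairwise_def disjnt_def edge_vars_def)
  moreover have "edge_vars e \<subseteq> ?X" if "e \<in> F" for e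
    using that F(1) assms(1) by (auto simp: edge_vars_def graph_vars_def simple_graph_def)
  \<comment> \<open>Each block consists of an edge and its two endpoints, so \<open>k = 3\<close>
    and the factor is \<open>7 / 8\<close>.\<close>
  ultimately have bound: "real (card {A. A \<subseteq> ?X \<and> (\<forall>e\<in>F. A \<inter> edge_vars e \<noteq> {x e})})
      \<le> (1 - 1 / 2 ^ 3) ^ card F * 2 ^ card ?X"
    using fin x F(1) card_edge_vars[OF assms(1)]
    by (intro card_avoiding_patterns_le) auto
  have "measure (VE_space V E) \<S> * 2 ^ card ?X
      \<le> card {A. A \<subseteq> ?X \<and> completed_assignment V E A \<in> \<S>}"
    by (rule measure_VE_space_le_card[OF assms(1,4)])
  also have "\<dots>
      \<le> card {A. A \<subseteq> ?X \<and> (\<forall>e\<in>F. A \<inter> edge_vars e \<noteq> {x e})}"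
    using fin avoid by (intro of_nat_mono card_mono) auto
  also note bound
  finally have "measure (VE_space V E) \<S> \<le> (7 / 8) ^ card F"
    by simp
  \<comment> \<open>As the image of \<open>F\<close>, \<open>M\<close> has at most
    \<open>card F\<close> elements, and powers of \<open>7 / 8\<close> decrease.\<close>
  also have "\<dots> \<le> (7 / 8) ^ card M"
    unfolding M by (rule power_decreasing) (use fin in \<open>auto intro: card_image_le\<close>)
  finally show ?thesis .
qed

end
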